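(* Let $g:\mathbb{Z}^n \to \mathbb{R}\cup\{+\infty\}$ be a semi-strictly quasi L$^{\natural}$-convex function with $\arg\min g \neq \emptyset$. A vector $p \in \mathrm{dom}\, g$ is a minimizer of $g$ if and only if $g(p+ \sigma e_X) \ge g(p)$ holds for every $\sigma \in \{+1, -1\}$ and every $X \subseteq N$.
   Context: Notation: $n$ is a positive integer, $N=\{1,\dots,n\}$; for $X\subseteq N$, $e_X\in\{0,1\}^n$ is the characteristic vector of $X$ ($e_X(i)=1$ if $i\in X$, and $e_X(i)=0$ otherwise); $\mathbf{1}=(1,\dots,1)$; $p\wedge q$ and $p\vee q$ denote the component-wise minimum and maximum of $p,q\in\mathbb{Z}^n$; $\mathrm{dom}\, g=\{p\in\mathbb{Z}^n\mid g(p)<+\infty\}$; $\arg\min g$ is the set of minimizers of $g$ (vectors in $\mathrm{dom}\, g$ attaining the minimum of $g$). Definition. A function $g:\mathbb{Z}^n\to\mathbb{R}\cup\{+\infty\}$ is semi-strictly quasi L$^{\natural}$-convex if for every $p,q\in\mathrm{dom}\, g$ and every nonnegative integer $\lambda$, both (I) and (II) hold: (I) at least one of the following holds: (a) $g(p)>g((p-\lambda\mathbf{1})\vee q)$; (b) $g(q)>g(p\wedge(q+\lambda\mathbf{1}))$; (c) $g(p)=g((p-\lambda\mathbf{1})\vee q)$ and $g(q)=g(p\wedge(q+\lambda\mathbf{1}))$. (II) at least one of the following holds: (a) $g(q)>g((p-\lambda\mathbf{1})\vee q)$; (b) $g(p)>g(p\wedge(q+\lambda\mathbf{1}))$; (c)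 $g(q)=g((p-\lambda\mathbf{1})\vee q)$ and $g(p)=g(p\wedge(q+\lambda\mathbf{1}))$. *)

theory Defs
  imports "HOL-Analysis.Finite_Cartesian_Product" "HOL-Library.Extended_Real"
begin

text \<open>
  The lattice \<open>\<int>\<^sup>n\<close> is \<open>int ^ 'n\<close> with \<open>'n\<close> a finite index type playing the role of
  \<open>N = {1,\<dots>,n}\<close>; it is nonempty, so \<open>n \<ge> 1\<close>. The all-ones vector is \<open>1 :: int ^ 'n\<close>, and
  \<open>c *s v\<close> is the component-wise multiple. Functions into \<open>\<real> \<union> {+\<infinity>}\<close> are \<open>ereal\<close>-valued
  functions that avoid \<open>-\<infinity>\<close>.
\<close>

definition char_vec :: "'n set \<Rightarrow> int ^ 'n"
  where "char_vec X = (\<chi> i. if i \<in> X then 1 else 0)"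

definition vmin :: "int ^ 'n \<Rightarrow> int ^ 'n \<Rightarrow> int ^ 'n"  (infixl \<open>\<sqinter>\<^sub>v\<close> 60)
  where "p \<sqinter>\<^sub>v q = (\<chi> i. min (p $ i) (q $ i))"

definition vmax :: "int ^ 'n \<Rightarrow> int ^ 'n \<Rightarrow> int ^ 'n"  (infixl \<open>\<squnion>\<^sub>v\<close> 60)
  where "p \<squnion>\<^sub>v q = (\<chi> i. max (p $ i) (q $ i))"

definition eff_dom :: "(int ^ 'n \<Rightarrow> ereal) \<Rightarrow> (int ^ 'n) set"
  where "eff_dom g = {p. g p < \<infinity>}"

definition minimizers :: "(int ^ 'n \<Rightarrow> ereal) \<Rightarrow> (int ^ 'n) set"
  where "minimizers g = {p \<in> eff_dom g. \<forall>q. g p \<le> g q}"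

definition semistrictly_quasi_Lnat_convex :: "(int ^ 'n \<Rightarrow> ereal) \<Rightarrow> bool"
  where "semistrictly_quasi_Lnat_convex g \<longleftrightarrow>
    (\<forall>p \<in> eff_dom g. \<forall>q \<in> eff_dom g. \<forall>l :: nat.
      (let u = (p - int l *s 1) \<squnion>\<^sub>v q;
           w = p \<sqinter>\<^sub>v (q + int l *s 1)
       in (g p > g u \<or> g q > g w \<or> (g p = g u \<and> g q = g w))
        \<and> (g q > g u \<or> g p > g w \<or> (g q = g u \<and> g p = g w))))"

end

theory Submission
  imports Defs
begin

text \<open>
  Why a local minimum is global: a minimizer \<open>q\<close> can be walked to \<open>p\<close> without ever leaving the
  set of minimizers. If \<open>q \<noteq> p\<close>, one of the two vectors, say \<open>r\<close>, exceeds the other, \<open>s\<close>, in some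
  component. Let \<open>X\<close> be the set of components in which \<open>r - s\<close> is largest. Part (II) of the definition,
  with \<open>\<lambda>\<close> one less than that largest difference, compares the pair \<open>r, s\<close> with the pair
  \<open>r - e\<^sub>X, s + e\<^sub>X\<close> (lemma \<open>exchange_toward\<close>): one of the moves \<open>r \<rightarrow> r - e\<^sub>X\<close>,
  \<open>s \<rightarrow> s + e\<^sub>X\<close> strictly decreases \<open>g\<close>, or both leave \<open>g\<close> unchanged. The move that starts at
  \<open>q\<close> cannot decrease \<open>g\<close> because \<open>q\<close> is a minimizer, and the one that starts at \<open>p\<close> cannot
  because \<open>p\<close> is a local minimum. So \<open>g\<close> is unchanged and \<open>q\<close> moves to a minimizer that is nearer
  to \<open>p\<close> in the \<open>\<ell>\<^sub>1\<close>-distance. Hence a minimizer nearest to \<open>p\<close> is \<open>p\<close> itself.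
\<close>

definition l1_dist :: "int ^ 'n::finite \<Rightarrow> int ^ 'n \<Rightarrow> nat"
  where "l1_dist p q = (\<Sum>i\<in>UNIV. nat \<bar>p $ i - q $ i\<bar>)"

lemma l1_dist_commute: "l1_dist p q = l1_dist q p"
  by (simp add: l1_dist_def abs_minus_commute)

lemma l1_dist_step_down:
  assumes "X \<noteq> {}" and less: "\<And>i. i \<in> X \<Longrightarrow> q $ i < r $ i"
  shows "l1_dist (r - char_vec X) q < l1_dist r q"
proof -
  obtain j where "j \<in> X"
    using \<open>X \<noteq> {}\<close> by blast
  show ?thesis
    unfolding l1_dist_def
  proof (rule sum_strict_mono_ex1)
    show "\<forall>i\<in>UNIV. nat \<bar>(r - char_vec X) $ i - q $ i\<bar> \<le> nat \<bar>r $ i - q $ i\<bar>"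
      using less by (force simp: char_vec_def)
    show "\<exists>i\<in>UNIV. nat \<bar>(r - char_vec X) $ i - q $ i\<bar> < nat \<bar>r $ i - q $ i\<bar>"
      using \<open>j \<in> X\<close> less[of j] by (intro bexI[of _ j]) (auto simp: char_vec_def)
  qed simp
qed

lemma l1_dist_step_up:
  assumes "X \<noteq> {}" and less: "\<And>i. i \<in> X \<Longrightarrow> q $ i < r $ i"
  shows "l1_dist (q + char_vec X) r < l1_dist q r"
proof -
  have "l1_dist (q + char_vec X) r = l1_dist (r - char_vec X) q"
    unfolding l1_dist_def by (intro sum.cong) (auto simp: abs_if)
  then show ?thesis
    using l1_dist_step_down[OF assms] by (simp add: l1_dist_commute)
qed

text \<open>
  Only the components where \<open>r - s\<close> attains its maximum \<open>m\<close> are affected when \<open>r\<close> is lowered by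
  \<open>m - 1\<close> before the join with \<open>s\<close>, and there the join exceeds \<open>s\<close> by exactly one; dually for the
  meet. This turns the lattice operations of the definition into unit steps towards each other.
\<close>

lemma exchange_toward:
  fixes g :: "int ^ 'n::finite \<Rightarrow> ereal"
  assumes g: "semistrictly_quasi_Lnat_convex g"
    and dom: "r \<in> eff_dom g" "s \<in> eff_dom g"
    and less: "s $ j < r $ j"
  obtains X where "X \<noteq> {}" "\<And>i. i \<in> X \<Longrightarrow> s $ i < r $ i"
    "g (s + char_vec X) < g s \<or> g (r - char_vec X) < g r \<or>
     (g (s + char_vec X) = g s \<and> g (r - char_vec X) = g r)"
proof -
  define m where "m = Max (range (\<lambda>i. r $ i - s $ i))"
  define X where "X = {i. r $ i - s $ i = m}"
  have le: "r $ i - s $ i \<le> m" for i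
    unfolding m_def by (intro Max_ge) auto
  have pos: "0 < m"
    using le[of j] less by linarith
  have "m \<in> range (\<lambda>i. r $ i - s $ i)"
    unfolding m_def by (intro Max_in) auto
  then have "X \<noteq> {}"
    by (auto simp: X_def)
  moreover have "s $ i < r $ i" if "i \<in> X" for i
    using that pos by (simp add: X_def)
  moreover have "r - int (nat (m - 1)) *s 1 \<squnion>\<^sub>v s = s + char_vec X"
  proof (rule vec_eq_iff[THEN iffD2, rule_format])
    fix i
    show "(r - int (nat (m - 1)) *s 1 \<squnion>\<^sub>v s) $ i = (s + char_vec X) $ i"
      using le[of i] pos by (auto simp: vmax_def char_vec_def X_def)
  qed
  moreover have "r \<sqinter>\<^sub>v (s + int (nat (m - 1)) *s 1) = r - char_vec X"
  proof (rule vec_eq_iff[THEN iffD2, rule_format])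
    fix i
    show "(r \<sqinter>\<^sub>v (s + int (nat (m - 1)) *s 1)) $ i = (r - char_vec X) $ i"
      using le[of i] pos by (auto simp: vmin_def char_vec_def X_def)
  qed
  moreover have "let u = r - int (nat (m - 1)) *s 1 \<squnion>\<^sub>v s;
      w = r \<sqinter>\<^sub>v (s + int (nat (m - 1)) *s 1)
    in g s > g u \<or> g r > g w \<or> (g s = g u \<and> g r = g w)"
    using g dom unfolding semistrictly_quasi_Lnat_convex_def Let_def by blast
  ultimately show thesis
    using that[of X] unfolding Let_def by metis
qed

lemma closer_minimizer:
  fixes g :: "int ^ 'n::finite \<Rightarrow> ereal"
  assumes g: "semistrictly_quasi_Lnat_convex g"
    and p: "p \<in> eff_dom g"
    and up: "\<And>X. g p \<le> g (p + char_vec X)" and down: "\<And>X. g p \<le> g (p - char_vec X)"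
    and q: "q \<in> minimizers g" and "q \<noteq> p"
  obtains q' where "q' \<in> minimizers g" "l1_dist q' p < l1_dist q p"
proof -
  have q_dom: "q \<in> eff_dom g" and q_min: "\<And>x. g q \<le> g x"
    using q by (auto simp: minimizers_def)
  have minimizer: "x \<in> minimizers g" if "g x = g q" for x
    using that q by (simp add: minimizers_def eff_dom_def)
  obtain j where "q $ j \<noteq> p $ j"
    using \<open>q \<noteq> p\<close> by (auto simp: vec_eq_iff)
  then consider "p $ j < q $ j" | "q $ j < p $ j"
    by linarith
  then show thesis
  proof cases
    case 1
    then obtain X where X: "X \<noteq> {}" "\<And>i. i \<in> X \<Longrightarrow> p $ i < q $ i"
      and alt: "g (p + char_vec X) < g p \<or> g (q - char_vec X) < g q \<or>
        (g (p + char_vec X) = g p \<and> g (q - char_vec X) = g q)"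
      using exchange_toward[OF g q_dom p] by blast
    have "g (q - char_vec X) = g q"
      using alt up[of X] q_min[of "q - char_vec X"] by (meson not_le)
    then show thesis
      using that minimizer l1_dist_step_down[OF X] by blast
  next
    case 2
    then obtain X where X: "X \<noteq> {}" "\<And>i. i \<in> X \<Longrightarrow> q $ i < p $ i"
      and alt: "g (q + char_vec X) < g q \<or> g (p - char_vec X) < g p \<or>
        (g (q + char_vec X) = g q \<and> g (p - char_vec X) = g p)"
      using exchange_toward[OF g p q_dom] by blast
    have "g (q + char_vec X) = g q"
      using alt down[of X] q_min[of "q + char_vec X"] by (meson not_le)
    then show thesis
      using that minimizer l1_dist_step_up[OF X] by blast
  qed
qed

theorem theorem1p1:
  fixes g :: "int ^ 'n::finite \<Rightarrow> ereal" and p :: "int ^ 'n"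
  assumes "\<And>x. g x \<noteq> -\<infinity>"
    and "semistrictly_quasi_Lnat_convex g"
    and "minimizers g \<noteq> {}"
    and "p \<in> eff_dom g"
  shows "p \<in> minimizers g \<longleftrightarrow>
    (\<forall>\<sigma> \<in> {1, -1 :: int}. \<forall>X :: 'n set. g (p + \<sigma> *s char_vec X) \<ge> g p)"
proof
  assume "p \<in> minimizers g"
  then show "\<forall>\<sigma> \<in> {1, -1 :: int}. \<forall>X :: 'n set. g (p + \<sigma> *s char_vec X) \<ge> g p"
    by (simp add: minimizers_def)
next
  assume local: "\<forall>\<sigma> \<in> {1, -1 :: int}. \<forall>X :: 'n set. g (p + \<sigma> *s char_vec X) \<ge> g p"
  have up: "g p \<le> g (p + char_vec X)" for X
    using local by simp
  have down: "g p \<le> g (p - char_vec X)" for X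
  proof -
    have "p + (-1) *s char_vec X = p - char_vec X"
      by (simp add: vec_eq_iff)
    then show ?thesis
      using local[rule_format, of "-1" X] by simp
  qed
  obtain q0 where "q0 \<in> minimizers g"
    using assms(3) by blast
  then obtain q where q: "q \<in> minimizers g"
    and nearest: "\<And>q'. q' \<in> minimizers g \<Longrightarrow> l1_dist q p \<le> l1_dist q' p"
    using ex_has_least_nat[of "\<lambda>q. q \<in> minimizers g" q0 "\<lambda>q. l1_dist q p"] by blast
  have "q = p"
  proof (rule ccontr)
    assume "q \<noteq> p"
    then obtain q' where "q' \<in> minimizers g" "l1_dist q' p < l1_dist q p"
      using closer_minimizer[OF assms(2,4) up down q] by blast
    then show False
      using nearest[of q'] by simp
  qed
  then show "p \<in> minimizers g"
    using q by simp
qed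

end
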